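(* Let $q$ be such that $q$ and $q+2$ are both odd prime powers, and let $G=\mathbb{F}_q\times\mathbb{F}_{q+2}$ be the direct product of the additive groups of the finite fields of orders $q$ and $q+2$. Then there exists a $q$-dimensional difference set in $G$ with parameters $(4m-1,2m-1,m-1)$ for $m=(q+1)^2/4$.
   Context: Let $G$ be an additively written (not necessarily abelian) group of order $v$. A $(v,k,\lambda)$ difference set in $G$ is a subset $D\subseteq G$ of size $k$ such that every $g\in G\setminus\{0\}$ can be written as $g=d_1-d_2$ for exactly $\lambda$ choices of $(d_1,d_2)\in D\times D$. An $n$-dimensional $(v,k,\lambda)$ difference set in $G$ is a set of $n$-tuples $D\subseteq G^n$ of size $k$ such that for all $1\le x<y\le n$ the set $\{d_x-d_y\mid d\in D\}\subseteq G$ is a $(v,k,\lambda)$ difference set in $G$, where $d=(d_1,\ldots,d_n)$. *)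

theory Defs
  imports
    "HOL-Library.Cardinality"
    "HOL-Library.FuncSet"
    "HOL-Library.Product_Plus"
    "HOL-Number_Theory.Prime_Powers"
begin

text \<open>
  The ambient group is a finite type of class \<open>group_add\<close>, which does not require commutativity.
\<close>

definition difference_set :: "nat \<Rightarrow> nat \<Rightarrow> nat \<Rightarrow> 'g::{group_add,finite} set \<Rightarrow> bool" where
  "difference_set v k l D \<longleftrightarrow>
     CARD('g) = v \<and> card D = k \<and>
     (\<forall>g. g \<noteq> 0 \<longrightarrow> card {(d1, d2). (d1, d2) \<in> D \<times> D \<and> g = d1 - d2} = l)"

text \<open>
  An element of \<open>G\<^sup>n\<close> is an extensional function on \<open>{1..n}\<close>: it is \<open>undefined\<close> outside
  \<open>{1..n}\<close>, so equality of such functions is equality of \<open>n\<close>-tuples and \<open>card D\<close> counts tuples.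
\<close>

definition multidim_difference_set ::
    "nat \<Rightarrow> nat \<Rightarrow> nat \<Rightarrow> nat \<Rightarrow> (nat \<Rightarrow> 'g::{group_add,finite}) set \<Rightarrow> bool" where
  "multidim_difference_set n v k l D \<longleftrightarrow>
     CARD('g) = v \<and> D \<subseteq> ({1..n} \<rightarrow>\<^sub>E UNIV) \<and> card D = k \<and>
     (\<forall>x y. 1 \<le> x \<and> x < y \<and> y \<le> n \<longrightarrow> difference_set v k l {d x - d y |d. d \<in> D})"

end

theory Submission
  imports Defs "HOL-Library.Disjoint_Sets" "HOL-Library.Z2"
begin

text \<open>
  The idea is to find one ordinary difference set \<open>E\<close> in \<open>G\<close> with the required parameters and to
  spread it over \<open>q\<close> coordinates by scaling. Choose injections \<open>\<alpha>\<close> and \<open>\<beta>\<close> of \<open>{1..q}\<close>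
  into the two fields and attach to each \<open>(a, b)\<close> in \<open>E\<close> the tuple whose \<open>i\<close>-th entry is
  \<open>(\<alpha> i * a, \<beta> i * b)\<close>. The difference of the entries \<open>x\<close> and \<open>y\<close> is
  \<open>((\<alpha> x - \<alpha> y) * a, (\<beta> x - \<beta> y) * b)\<close>. Both scaling factors are nonzero, so these differences
  form the image of \<open>E\<close> under an automorphism of \<open>G\<close>, and an automorphism carries difference sets
  to difference sets with the same parameters (\<open>multidim_difference_set_if_scalings\<close>).
  The number \<open>q\<close> of coordinates is the largest for which \<open>\<alpha>\<close> exists.

  For \<open>E\<close> one takes the twin prime power difference set of Stanton and Sprott
  (\<open>twin_difference_set\<close>): the pairs \<open>(x, y)\<close> with \<open>y = 0\<close>, together with the pairs of nonzero
  elements that are both squares or both nonsquares. Its sign function (\<open>1\<close> on \<open>E\<close>, \<open>-1\<close> off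
  \<open>E\<close>) is a combination of four products of a function on the first field with a function on the
  second, each factor being a quadratic character \<open>\<chi>\<close>, the constant \<open>1\<close> or the indicator \<open>\<delta>\<close> of
  \<open>0\<close>. Correlations of products are products of correlations, and those of \<open>\<chi>\<close>, \<open>1\<close>, \<open>\<delta>\<close> are
  explicit, so the autocorrelation of the sign function can be written down; away from \<open>0\<close> it is
  constantly \<open>-1\<close>, which says that \<open>E\<close> is a difference set (\<open>difference_set_if_correlation\<close>).
  The only terms which could spoil this are those that pair the product of the two characters with
  the indicator of \<open>(0, 0)\<close>. They cancel because exactly one of \<open>q\<close> and \<open>q + 2\<close> is congruent to
  \<open>3\<close> modulo \<open>4\<close>, so that \<open>-1\<close> is a square in exactly one of the two fields
  (\<open>quadratic_char_minus_1\<close>).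
\<close>

section \<open>The quadratic character of a finite field\<close>

lemma even_card_if_fixpoint_free_involution:
  assumes "finite S" "\<And>x. x \<in> S \<Longrightarrow> f x \<in> S" "\<And>x. x \<in> S \<Longrightarrow> f (f x) = x"
    "\<And>x. x \<in> S \<Longrightarrow> f x \<noteq> x"
  shows "even (card S)"
proof -
  \<comment> \<open>In characteristic 2 the ones over an orbit \<open>{x, f x}\<close> cancel.\<close>
  have "(\<Sum>x\<in>S. 1 :: bit) = 0"
    by (rule sum_involution_eq_0[of S "\<lambda>_. 1" f]) (use assms in auto)
  then have "even (of_nat (card S) :: bit)" by simp
  then show ?thesis by (simp only: even_of_nat_iff)
qed

text \<open>
  In characteristic 2, translation by 1 would pair off the elements of the field.
\<close>

lemma two_neq_zero_if_odd_card:
  assumes "odd CARD('a::{field,finite})"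
  shows "(2::'a) \<noteq> 0"
proof
  assume two: "(2::'a) = 0"
  have "even CARD('a)"
  proof (rule even_card_if_fixpoint_free_involution[where f = "\<lambda>x. x + 1"])
    show "x + 1 + 1 = x" for x :: 'a using two by (simp add: add.assoc)
  qed auto
  with assms show False by simp
qed

lemma minus_eq_self_iff_if_odd_card:
  fixes x :: "'a::{field,finite}"
  assumes "odd CARD('a)"
  shows "- x = x \<longleftrightarrow> x = 0"
proof -
  have "- x = x \<longleftrightarrow> 2 * x = 0"
    by (metis add_eq_0_iff mult_2)
  then show ?thesis using two_neq_zero_if_odd_card[OF assms] by simp
qed

definition nonzero_squares :: "'a::{field,finite} set" where
  "nonzero_squares = (\<lambda>x. x\<^sup>2) ` (- {0})"

definition quadratic_char :: "'a::{field,finite} \<Rightarrow> int" where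
  "quadratic_char x = (if x = 0 then 0 else if x \<in> nonzero_squares then 1 else - 1)"

lemma nonzero_squares_mult:
  "x \<in> nonzero_squares \<Longrightarrow> y \<in> nonzero_squares \<Longrightarrow> x * y \<in> nonzero_squares"
  by (auto simp: nonzero_squares_def image_iff simp flip: power_mult_distrib)

lemma nonzero_squares_inverse:
  "x \<in> nonzero_squares \<Longrightarrow> inverse x \<in> nonzero_squares"
  by (auto simp: nonzero_squares_def image_iff simp flip: power_inverse)

lemma zero_notin_nonzero_squares: "0 \<notin> nonzero_squares"
  by (auto simp: nonzero_squares_def)

lemma one_in_nonzero_squares: "1 \<in> nonzero_squares"
  unfolding nonzero_squares_def by (rule image_eqI[of _ _ 1]) auto

text \<open>
  Squaring is two-to-one on the nonzero elements, because \<open>x\<close> and \<open>-x\<close> differ.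
\<close>

lemma card_nonzero_squares:
  assumes "odd CARD('a::{field,finite})"
  shows "2 * card (nonzero_squares :: 'a set) + 1 = CARD('a)"
proof -
  let ?U = "- {0 :: 'a}"
  have fibre: "card {x \<in> ?U. x\<^sup>2 = y} = 2" if "y \<in> nonzero_squares" for y
  proof -
    from that obtain x where x: "x \<noteq> 0" "y = x\<^sup>2"
      by (auto simp: nonzero_squares_def)
    have "{x \<in> ?U. x\<^sup>2 = y} = {x, - x}"
      using x by (auto simp: power2_eq_iff)
    then show ?thesis
      using x minus_eq_self_iff_if_odd_card[OF assms, of x] by (simp add: card_2_iff)
  qed
  have "card ?U = (\<Sum>y\<in>nonzero_squares. card {x \<in> ?U. x\<^sup>2 = y})"
    using sum.image_gen[of ?U "\<lambda>_. 1::nat" "\<lambda>x. x\<^sup>2"] by (simp add: nonzero_squares_def)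
  also have "\<dots> = 2 * card (nonzero_squares :: 'a set)"
    using fibre by simp
  finally have "card ?U = 2 * card (nonzero_squares :: 'a set)" .
  moreover have "card ?U + 1 = CARD('a)"
    by (simp add: card_Diff_singleton Compl_eq_Diff_UNIV)
  ultimately show ?thesis by simp
qed

text \<open>
  Multiplication by a nonsquare sends squares to nonsquares. There are as many nonzero nonsquares as
  nonzero squares, so it already exhausts the nonsquares in this way and must send each nonsquare to
  a square.
\<close>

lemma nonsquare_mult_nonsquare:
  fixes x y :: "'a::{field,finite}"
  assumes odd: "odd CARD('a)"
    and x: "x \<noteq> 0" "x \<notin> nonzero_squares" and y: "y \<noteq> 0" "y \<notin> nonzero_squares"
  shows "x * y \<in> nonzero_squares"
proof -
  let ?S = "nonzero_squares :: 'a set"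
  let ?N = "- {0} - ?S"
  have sub: "(*) x ` ?S \<subseteq> ?N"
  proof
    fix z assume "z \<in> (*) x ` ?S"
    then obtain s where s: "s \<in> ?S" "z = x * s" by auto
    have "s \<noteq> 0" using s zero_notin_nonzero_squares by metis
    moreover have "x = z * inverse s" using s \<open>s \<noteq> 0\<close> by simp
    then have "z \<notin> ?S" using x nonzero_squares_mult nonzero_squares_inverse s by metis
    ultimately show "z \<in> ?N" using s x by simp
  qed
  have "card ?N = card ?S"
    using card_nonzero_squares[OF odd] zero_notin_nonzero_squares
    by (subst card_Diff_subset) (auto simp: card_Diff_singleton Compl_eq_Diff_UNIV)
  moreover have inj: "inj ((*) x)" using x by (simp add: inj_on_def)
  ultimately have "(*) x ` ?S = ?N"
    using sub card_image[OF inj_on_subset[OF inj subset_UNIV]] by (intro card_subset_eq) auto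
  moreover have "x * y \<notin> (*) x ` ?S"
    using y by (simp add: inj_image_mem_iff[OF inj])
  ultimately have "x * y \<notin> ?N" by simp
  then show ?thesis using x y by simp
qed

lemma quadratic_char_mult:
  fixes x y :: "'a::{field,finite}"
  assumes "odd CARD('a)"
  shows "quadratic_char (x * y) = quadratic_char x * quadratic_char y"
proof -
  have "x * y \<notin> nonzero_squares" if "x \<in> nonzero_squares" "y \<noteq> 0" "y \<notin> nonzero_squares" for x y :: 'a
  proof
    assume "x * y \<in> nonzero_squares"
    then have "inverse x * (x * y) \<in> nonzero_squares"
      using nonzero_squares_mult nonzero_squares_inverse that by blast
    moreover have "x \<noteq> 0" using that zero_notin_nonzero_squares by metis
    ultimately show False using that by (simp flip: mult.assoc)
  qed
  from this[of x y] this[of y x] show ?thesis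
    using nonsquare_mult_nonsquare[OF assms, of x y] nonzero_squares_mult[of x y]
    by (auto simp: quadratic_char_def mult.commute)
qed

lemma quadratic_char_0 [simp]: "quadratic_char 0 = 0"
  by (simp add: quadratic_char_def)

lemma quadratic_char_1 [simp]: "quadratic_char 1 = 1"
  by (simp add: quadratic_char_def one_in_nonzero_squares)

lemma quadratic_char_cases: "x \<noteq> 0 \<Longrightarrow> quadratic_char x = 1 \<or> quadratic_char x = - 1"
  by (simp add: quadratic_char_def)

lemma quadratic_char_self_mult: "quadratic_char x * quadratic_char x = (if x = 0 then 0 else 1)"
  by (simp add: quadratic_char_def)

text \<open>
  Inversion acts on the nonzero squares and fixes only \<open>1\<close> and, if it is a square, \<open>-1\<close>.
  Pairing off the rest shows that \<open>-1\<close> is a square exactly if the number of nonzero squares is even.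
\<close>

lemma quadratic_char_minus_1:
  assumes "odd CARD('a::{field,finite})"
  shows "quadratic_char (- 1 :: 'a) = (- 1) ^ ((CARD('a) - 1) div 2)"
proof -
  let ?S = "nonzero_squares :: 'a set"
  have card: "(CARD('a) - 1) div 2 = card ?S"
    using card_nonzero_squares[OF assms] by simp
  have even: "even (card (?S - {1, - 1}))"
  proof (rule even_card_if_fixpoint_free_involution[where f = inverse])
    fix x assume x: "x \<in> ?S - {1, - 1}"
    then have "x \<noteq> 0" using zero_notin_nonzero_squares by auto
    show "inverse x \<in> ?S - {1, - 1}"
      using x nonzero_squares_inverse
      by (auto simp: inverse_eq_iff_eq[of x 1, simplified]) (metis inverse_inverse_eq inverse_minus_eq inverse_1)
    show "inverse x \<noteq> x"
    proof
      assume "inverse x = x"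
      then have "x\<^sup>2 = 1" using \<open>x \<noteq> 0\<close> by (metis power2_eq_square right_inverse)
      then show False using x by (auto simp: power2_eq_1_iff)
    qed
  qed auto
  have ne: "(- 1 :: 'a) \<noteq> 1" using minus_eq_self_iff_if_odd_card[OF assms, of 1] by simp
  show ?thesis
  proof (cases "- 1 \<in> ?S")
    case True
    have "card ?S = card (?S - {1, - 1}) + card {1, - 1 :: 'a}"
      using True one_in_nonzero_squares
      by (subst card_Diff_subset) (auto intro!: le_add_diff_inverse2[symmetric] card_mono)
    also have "card {1, - 1 :: 'a} = 2" using ne by (metis card_2_iff)
    finally have "even (card ?S)" using even by simp
    then show ?thesis using True unfolding card by (simp add: quadratic_char_def)
  next
    case False
    then have "?S - {1, - 1} = ?S - {1}" by auto
    then have "card ?S = Suc (card (?S - {1, - 1}))"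
      using one_in_nonzero_squares by (metis card_Suc_Diff1 finite)
    then have "odd (card ?S)" using even by simp
    then show ?thesis using False unfolding card by (simp add: quadratic_char_def)
  qed
qed

lemma sum_quadratic_char:
  assumes "odd CARD('a::{field,finite})"
  shows "(\<Sum>x\<in>(UNIV :: 'a set). quadratic_char x) = 0"
proof -
  let ?S = "nonzero_squares :: 'a set"
  have "(\<Sum>x\<in>(UNIV :: 'a set). quadratic_char x)
      = (\<Sum>x\<in>UNIV. 2 * of_bool (x \<in> ?S) + of_bool (x = 0) - 1)"
    by (rule sum.cong) (auto simp: quadratic_char_def zero_notin_nonzero_squares)
  also have "\<dots> = 2 * int (card ?S) + 1 - int CARD('a)"
    by (simp add: sum.distrib sum_subtractf flip: sum_distrib_left) 
  finally show ?thesis using card_nonzero_squares[OF assms] by linarith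
qed

section \<open>Correlations\<close>

definition correlation :: "('g::{group_add,finite} \<Rightarrow> int) \<Rightarrow> ('g \<Rightarrow> int) \<Rightarrow> 'g \<Rightarrow> int" where
  "correlation u w g = (\<Sum>h\<in>UNIV. u (g + h) * w h)"

definition delta :: "'g::zero \<Rightarrow> int" where
  "delta x = (if x = 0 then 1 else 0)"

lemma sum_shift:
  fixes g :: "'g::{group_add,finite}"
  shows "(\<Sum>h\<in>UNIV. u (g + h)) = (\<Sum>h\<in>UNIV. u h)"
  by (rule sum.reindex_bij_witness[of _ "\<lambda>h. - g + h" "\<lambda>h. g + h"]) (auto simp: add.assoc[symmetric])

lemma sum_delta: "(\<Sum>h\<in>(UNIV :: 'g::{zero,finite} set). delta h) = 1"
  by (simp add: delta_def)

lemma correlation_const: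
  "correlation u (\<lambda>_. c) g = (\<Sum>h\<in>UNIV. u h) * c"
  "correlation (\<lambda>_. c) w g = c * (\<Sum>h\<in>UNIV. w h)"
  by (simp_all add: correlation_def sum_shift[where u = u] flip: sum_distrib_left sum_distrib_right)

lemma correlation_delta:
  "correlation u delta g = u g"
  "correlation delta w g = w (- g)"
proof -
  have "correlation u delta g = (\<Sum>h\<in>UNIV. if h = 0 then u (g + h) else 0)"
    unfolding correlation_def delta_def by (rule sum.cong) auto
  then show "correlation u delta g = u g" by simp
  have "correlation delta w g = (\<Sum>h\<in>UNIV. if h = - g then w h else 0)"
    unfolding correlation_def delta_def by (rule sum.cong) (auto simp: add_eq_0_iff)
  then show "correlation delta w g = w (- g)" by simp
qed

text \<open>
  For \<open>g \<noteq> 0\<close>, multiplicativity turns \<open>\<chi> (g + h) * \<chi> h\<close> into \<open>\<chi> (g / h + 1)\<close> whenever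
  \<open>h \<noteq> 0\<close>. As \<open>h\<close> varies, the argument runs through all elements but \<open>1\<close>, and the full sum of
  \<open>\<chi>\<close> vanishes.
\<close>

lemma correlation_quadratic_char:
  fixes g :: "'a::{field,finite}"
  assumes "odd CARD('a)"
  shows "correlation quadratic_char quadratic_char g = int CARD('a) * delta g - 1"
proof (cases "g = 0")
  case True
  have "correlation quadratic_char quadratic_char (0::'a) = (\<Sum>h\<in>(UNIV :: 'a set). 1 - delta h)"
    unfolding correlation_def by (rule sum.cong) (auto simp: quadratic_char_self_mult delta_def)
  then show ?thesis using True by (simp add: sum_subtractf sum_delta) (simp add: delta_def)
next
  case False
  have "correlation quadratic_char quadratic_char g
      = (\<Sum>h\<in>- {0}. quadratic_char (g + h) * quadratic_char h)"
    unfolding correlation_def by (rule sum.mono_neutral_right) auto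
  also have "\<dots> = (\<Sum>t\<in>- {1 :: 'a}. quadratic_char t)"
  proof (rule sum.reindex_bij_witness[of _ "\<lambda>t. g / (t - 1)" "\<lambda>h. g / h + 1"])
    fix h :: 'a assume h: "h \<in> - {0}"
    have "g + h = (g / h + 1) * h"
      using h by (simp add: distrib_right)
    then have "quadratic_char (g + h) = quadratic_char (g / h + 1) * quadratic_char h"
      by (simp only: quadratic_char_mult[OF assms])
    then show "quadratic_char (g / h + 1) = quadratic_char (g + h) * quadratic_char h"
      using h by (simp add: mult.assoc quadratic_char_self_mult)
  qed (use False in auto)
  also have "\<dots> = (\<Sum>t\<in>(UNIV :: 'a set). quadratic_char t) - quadratic_char (1 :: 'a)"
    by (simp add: Compl_eq_Diff_UNIV sum_diff1)
  finally show ?thesis using sum_quadratic_char[OF assms] False by (simp add: delta_def)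
qed

definition tensor :: "('a \<Rightarrow> int) \<Rightarrow> ('b \<Rightarrow> int) \<Rightarrow> 'a \<times> 'b \<Rightarrow> int" where
  "tensor u w = (\<lambda>(x, y). u x * w y)"

lemma sum_tensor:
  "(\<Sum>h\<in>(UNIV :: ('a::finite \<times> 'b::finite) set). tensor u w h)
    = (\<Sum>x\<in>UNIV. u x) * (\<Sum>y\<in>UNIV. w y)"
  unfolding tensor_def sum_product sum.cartesian_product by simp

lemma correlation_tensor:
  "correlation (tensor u u') (tensor w w') (a, b) = correlation u w a * correlation u' w' b"
  unfolding correlation_def tensor_def sum_product sum.cartesian_product 
  by (rule sum.cong) (auto simp: mult_ac)

lemma correlation_add_left: "correlation (\<lambda>h. u h + u' h) w g = correlation u w g + correlation u' w g"
  and correlation_diff_left: "correlation (\<lambda>h. u h - u' h) w g = correlation u w g - correlation u' w g"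
  and correlation_add_right: "correlation u (\<lambda>h. w h + w' h) g = correlation u w g + correlation u w' g"
  and correlation_diff_right: "correlation u (\<lambda>h. w h - w' h) g = correlation u w g - correlation u w' g"
  by (simp_all add: correlation_def algebra_simps sum.distrib sum_subtractf)

section \<open>Difference sets\<close>

text \<open>
  The indicator function of the set is \<open>(s + 1) / 2\<close>, and the number of ways to write \<open>g\<close> as a
  difference is the autocorrelation of this indicator at \<open>g\<close>. Expanding the product expresses it
  through the autocorrelation of \<open>s\<close> and the sum of \<open>s\<close>.
\<close>

lemma difference_set_if_correlation:
  fixes s :: "'g::{group_add,finite} \<Rightarrow> int"
  assumes sign: "\<And>h. s h = 1 \<or> s h = - 1"
    and sum: "(\<Sum>h\<in>UNIV. s h) = - 1"
    and corr: "\<And>g. g \<noteq> 0 \<Longrightarrow> correlation s s g = - 1"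
    and card: "CARD('g) + 1 = 4 * m"
  shows "difference_set (4 * m - 1) (2 * m - 1) (m - 1) {h. s h = 1}"
  unfolding difference_set_def
proof (intro conjI allI impI)
  have ind: "2 * of_bool (s h = 1) = s h + 1" for h using sign[of h] by auto
  let ?E = "{h. s h = 1}"
  have "2 * int (card ?E) = (\<Sum>h\<in>UNIV. 2 * of_bool (s h = 1))"
    by (simp flip: sum_distrib_left)
  also have "\<dots> = int CARD('g) - 1" unfolding ind by (simp add: sum.distrib sum)
  finally show "card ?E = 2 * m - 1" using card by linarith
  show "CARD('g) = 4 * m - 1" using card by simp
  fix g :: 'g assume g: "g \<noteq> 0"
  have "{(d1, d2). (d1, d2) \<in> ?E \<times> ?E \<and> g = d1 - d2}
      = (\<lambda>h. (g + h, h)) ` {h. s (g + h) = 1 \<and> s h = 1}"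
    by (force simp: image_iff)
  then have "card {(d1, d2). (d1, d2) \<in> ?E \<times> ?E \<and> g = d1 - d2}
      = card {h. s (g + h) = 1 \<and> s h = 1}"
    by (simp add: card_image inj_on_def)
  moreover have "4 * int (card {h. s (g + h) = 1 \<and> s h = 1})
      = (\<Sum>h\<in>UNIV. (2 * of_bool (s (g + h) = 1)) * (2 * of_bool (s h = 1)))"
  proof -
    have "(\<Sum>h\<in>UNIV. (2 * of_bool (s (g + h) = 1)) * (2 * of_bool (s h = 1)))
       = (\<Sum>h\<in>UNIV. 4 * of_bool (s (g + h) = 1 \<and> s h = 1) :: int)"
      by (rule sum.cong) auto
    then show ?thesis by (simp flip: sum_distrib_left)
  qed
  moreover have "\<dots> = (\<Sum>h\<in>UNIV. s (g + h) * s h + s (g + h) + s h + 1)"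
    unfolding ind by (rule sum.cong) (auto simp: algebra_simps)
  moreover have "\<dots> = int CARD('g) - 3"
    using corr[OF g] sum_shift[of s g] sum by (simp add: sum.distrib correlation_def)
  ultimately show "card {(d1, d2). (d1, d2) \<in> ?E \<times> ?E \<and> g = d1 - d2} = m - 1"
    using card by linarith
qed

lemma difference_set_image:
  fixes f :: "'g::{group_add,finite} \<Rightarrow> 'g"
  assumes D: "difference_set v k l D" and "inj f" and diff: "\<And>x y. f (x - y) = f x - f y"
  shows "difference_set v k l (f ` D)"
  unfolding difference_set_def
proof (intro conjI allI impI)
  show "CARD('g) = v" using D by (simp add: difference_set_def)
  show "card (f ` D) = k"
    using D \<open>inj f\<close> by (simp add: difference_set_def card_image inj_on_subset)
  fix g :: 'g assume g: "g \<noteq> 0"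
  have f0: "f 0 = 0" using diff[of 0 0] by simp
  obtain g' where g': "g = f g'"
    using \<open>inj f\<close> by (metis finite finite_UNIV_inj_surj surj_def)
  have "{(d1, d2). (d1, d2) \<in> f ` D \<times> f ` D \<and> g = d1 - d2}
      = map_prod f f ` {(d1, d2). (d1, d2) \<in> D \<times> D \<and> g' = d1 - d2}"
    (is "?L = ?R")
  proof
    show "?R \<subseteq> ?L" by (auto simp: g' diff)
    show "?L \<subseteq> ?R"
    proof clarify
      fix x y assume "x \<in> D" "y \<in> D" "g = f x - f y"
      moreover from this have "g' = x - y"
        using \<open>inj f\<close> by (simp add: g' inj_eq flip: diff)
      ultimately show "(f x, f y) \<in> ?R" by (intro image_eqI[of _ _ "(x, y)"]) auto
    qed
  qed
  then have "card {(d1, d2). (d1, d2) \<in> f ` D \<times> f ` D \<and> g = d1 - d2}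
      = card {(d1, d2). (d1, d2) \<in> D \<times> D \<and> g' = d1 - d2}"
    using card_image[OF inj_on_subset[OF prod.inj_map[OF \<open>inj f\<close> \<open>inj f\<close>] subset_UNIV]] by simp
  also have "\<dots> = l"
  proof -
    have "g' \<noteq> 0" using g g' f0 by auto
    then show ?thesis using D unfolding difference_set_def by blast
  qed
  finally show "card {(d1, d2). (d1, d2) \<in> f ` D \<times> f ` D \<and> g = d1 - d2} = l" .
qed

text \<open>
  The products of \<open>1\<close> and \<open>\<delta>\<close> give the value on the two axes, where the character term vanishes:
  \<open>1\<close> where \<open>y = 0\<close>, including the origin, and \<open>-1\<close> where \<open>x = 0\<close> and \<open>y \<noteq> 0\<close>.
\<close>

definition twin_sign :: "'a::{field,finite} \<times> 'b::{field,finite} \<Rightarrow> int" where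
  "twin_sign h = tensor quadratic_char quadratic_char h + tensor (\<lambda>_. 1) delta h
     - tensor delta (\<lambda>_. 1) h + tensor delta delta h"

text \<open>
  In the expansion of the autocorrelation at \<open>(a, b)\<close>, the mixed terms with the character product
  vanish because \<open>\<chi>\<close> sums to \<open>0\<close>, except for \<open>\<chi> a * \<chi> b + \<chi> (-a) * \<chi> (-b)\<close>, which
  vanishes because \<open>\<chi> (-1)\<close> has opposite signs in the two fields. What is left depends only on
  whether \<open>a\<close> and \<open>b\<close> are zero, and the field orders differing by exactly 2 make its value \<open>-1\<close>
  in each of the three cases with \<open>(a, b) \<noteq> (0, 0)\<close>.
\<close>

lemma twin_difference_set:
  assumes odd: "odd CARD('a::{field,finite})" and twin: "CARD('b::{field,finite}) = CARD('a) + 2"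
    and m: "4 * m = (CARD('a) + 1)\<^sup>2"
  shows "difference_set (4 * m - 1) (2 * m - 1) (m - 1) {h :: 'a \<times> 'b. twin_sign h = 1}"
proof (rule difference_set_if_correlation)
  have odd': "odd CARD('b)" using odd twin by simp
  show "twin_sign h = 1 \<or> twin_sign h = - 1" for h :: "'a \<times> 'b"
  proof (cases h)
    case (Pair x y)
    then show ?thesis
      using quadratic_char_cases[of x] quadratic_char_cases[of y]
      by (cases "x = 0"; cases "y = 0") (auto simp: twin_sign_def tensor_def delta_def)
  qed
  show "(\<Sum>h\<in>UNIV. twin_sign (h :: 'a \<times> 'b)) = - 1"
    using twin by (simp add: twin_sign_def sum.distrib sum_subtractf sum_tensor sum_delta
        sum_quadratic_char odd odd')
  show "CARD('a \<times> 'b) + 1 = 4 * m"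
    using m twin by (simp add: power2_eq_square)
  show "correlation twin_sign twin_sign g = - 1" if "g \<noteq> 0" for g :: "'a \<times> 'b"
  proof -
    obtain a b where g: "g = (a, b)" by (cases g)
    let ?q = "int CARD('a)"
    have minus: "quadratic_char (- a) * quadratic_char (- b) = - (quadratic_char a * quadratic_char b)"
    proof -
      have "(CARD('b) - 1) div 2 = Suc ((CARD('a) - 1) div 2)"
        using odd twin by (auto elim!: oddE)
      then have "quadratic_char (- 1 :: 'a) * quadratic_char (- 1 :: 'b) = - 1"
        by (simp add: quadratic_char_minus_1 odd odd' flip: power_add mult_2)
      moreover have "quadratic_char (- a) = quadratic_char (- 1 :: 'a) * quadratic_char a"
        using quadratic_char_mult[OF odd, of "- 1" a] by simp
      moreover have "quadratic_char (- b) = quadratic_char (- 1 :: 'b) * quadratic_char b"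
        using quadratic_char_mult[OF odd', of "- 1" b] by simp
      ultimately show ?thesis by (simp add: mult_ac)
    qed
    have "correlation twin_sign twin_sign g =
        (?q * delta a - 1) * ((?q + 2) * delta b - 1) + ?q * delta b - 2 + (?q + 2) * delta a
         + 2 * delta b - 2 * delta a + delta a * delta b"
      unfolding g twin_sign_def
      using minus odd odd' twin
      by (simp add: correlation_add_left correlation_diff_left correlation_add_right
        correlation_diff_right correlation_tensor correlation_const correlation_delta
        correlation_quadratic_char sum_quadratic_char sum_delta algebra_simps)
    then show ?thesis using that by (auto simp: g delta_def zero_prod_def algebra_simps)
  qed
qed

text \<open>
  Differences of distinct coordinates are images of \<open>E\<close> under injective additive maps. Such a map
  also recovers the index \<open>(a, b)\<close> from its tuple, so with at least two coordinates no two tuples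
  coincide.
\<close>

lemma multidim_difference_set_if_scalings:
  fixes E :: "('a::{field,finite} \<times> 'b::{field,finite}) set"
  assumes E: "difference_set v k l E" and n: "n \<ge> 2"
    and \<alpha>: "inj_on \<alpha> {1..n}" and \<beta>: "inj_on \<beta> {1..n}"
  shows "multidim_difference_set n v k l
    ((\<lambda>(a, b). \<lambda>i\<in>{1..n}. (\<alpha> i * a, \<beta> i * b)) ` E)"
proof -
  let ?t = "\<lambda>(a, b). \<lambda>i\<in>{1..n}. (\<alpha> i * a, \<beta> i * b)"
  let ?f = "\<lambda>x y (a, b). ((\<alpha> x - \<alpha> y) * a, (\<beta> x - \<beta> y) * b)"
  have diff: "?t h x - ?t h y = ?f x y h" if "x \<in> {1..n}" "y \<in> {1..n}" for x y h
    using that by (cases h) (simp add: algebra_simps)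
  have inj_f: "inj (?f x y)" if "x \<in> {1..n}" "y \<in> {1..n}" "x \<noteq> y" for x y
  proof -
    have "\<alpha> x \<noteq> \<alpha> y" "\<beta> x \<noteq> \<beta> y"
      using that \<alpha> \<beta> by (meson inj_onD)+
    then show ?thesis by (auto intro!: injI)
  qed
  have "inj ?t"
  proof (rule injI)
    fix h h' assume eq: "?t h = ?t h'"
    have "?f 1 2 h = ?f 1 2 h'"
      using n eq by (simp flip: diff)
    then show "h = h'" by (rule injD[OF inj_f, rotated 3]) (use n in auto)
  qed
  then have card: "card (?t ` E) = k"
    using E by (simp add: card_image inj_on_subset difference_set_def)
  have ds: "difference_set v k l {d x - d y |d. d \<in> ?t ` E}" if xy: "1 \<le> x" "x < y" "y \<le> n" for x y
  proof -
    have "{d x - d y |d. d \<in> ?t ` E} = (\<lambda>h. ?t h x - ?t h y) ` E"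
      unfolding Setcompr_eq_image image_image ..
    also have "\<dots> = ?f x y ` E" using xy by (intro image_cong refl diff) auto
    also have "difference_set v k l \<dots>"
      by (rule difference_set_image[OF E inj_f]) (use xy in \<open>auto simp: algebra_simps\<close>)
    finally show ?thesis .
  qed
  show ?thesis
    unfolding multidim_difference_set_def using E card ds
    by (auto simp: difference_set_def)
qed

theorem theorem4p3:
  fixes q m :: nat
  assumes "odd q" and "primepow q" and "odd (q + 2)" and "primepow (q + 2)"
    and "CARD('a::{field,finite}) = q"
    and "CARD('b::{field,finite}) = q + 2"
    and "real m = (real q + 1)\<^sup>2 / 4"
  shows "\<exists>D :: (nat \<Rightarrow> 'a \<times> 'b) set.
           multidim_difference_set q (4 * m - 1) (2 * m - 1) (m - 1) D"
proof -
  have "real (4 * m) = real ((q + 1)\<^sup>2)" using assms(7) by (simp add: add.commute)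
  then have m: "4 * m = (CARD('a) + 1)\<^sup>2" unfolding assms(5) of_nat_eq_iff .
  have "q > 1" using assms(2) by (simp add: primepow_gt_Suc_0)
  obtain \<alpha> :: "nat \<Rightarrow> 'a" where \<alpha>: "inj_on \<alpha> {1..q}"
    using card_le_inj[of "{1..q}" "UNIV :: 'a set"] assms(5) by auto
  obtain \<beta> :: "nat \<Rightarrow> 'b" where \<beta>: "inj_on \<beta> {1..q}"
    using card_le_inj[of "{1..q}" "UNIV :: 'b set"] assms(6) by auto
  show ?thesis
    using multidim_difference_set_if_scalings[OF twin_difference_set[OF _ _ m] _ \<alpha> \<beta>]
      assms \<open>q > 1\<close> by auto
qed

end
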